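(* Let $k\ge1$ and $l\ge1$ be integers, put $\mu=\max\{k,l\}$, and let $c>1$ be a constant. For any graph $G$ of order $n$ with minimum degree $\delta\ge c\mu-1$, $$\gamma_{k,l}(G)<\left(\frac{c}{\delta+1}+\frac{1}{e^{0.5\mu(c+1/c-2)}}\right)\mu n .$$
   Context: All graphs are finite, undirected, without loops and multiple edges (and nonempty). $N[v]$ denotes the closed neighbourhood of $v$ (the neighbours of $v$ together with $v$). For integers $k\ge1$ and $l\ge1$, a set $D\subseteq V(G)$ is a $(k,l)$-dominating set of $G$ if $|N[v]\cap D|\ge k$ for every vertex $v\notin D$ and $|N[v]\cap D|\ge l$ for every vertex $v\in D$. The parametric domination number $\gamma_{k,l}(G)$ is the minimum cardinality of a $(k,l)$-dominating set of $G$. *)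

theory Defs
  imports Complex_Main "Graph_Theory.Digraph"
begin

text \<open>
  A finite simple undirected graph is a finite, loop-free, symmetric digraph without multiple
  arcs, i.e. an instance of the locale \<^locale>\<open>graph\<close>: every undirected edge is represented by its
  two orientations. Hence the degree of a vertex is its out-degree.
\<close>

definition closed_nbhd :: "('a, 'b) pre_digraph \<Rightarrow> 'a \<Rightarrow> 'a set" where
  "closed_nbhd G v = insert v {u \<in> verts G. v \<rightarrow>\<^bsub>G\<^esub> u}"

definition min_degree :: "('a, 'b) pre_digraph \<Rightarrow> nat" where
  "min_degree G = Min (out_degree G ` verts G)"

definition kl_dominating_set ::
    "('a, 'b) pre_digraph \<Rightarrow> nat \<Rightarrow> nat \<Rightarrow> 'a set \<Rightarrow> bool" where
  "kl_dominating_set G k l D \<longleftrightarrow>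
     D \<subseteq> verts G \<and>
     (\<forall>v \<in> verts G - D. k \<le> card (closed_nbhd G v \<inter> D)) \<and>
     (\<forall>v \<in> D. l \<le> card (closed_nbhd G v \<inter> D))"

text \<open>
  Meaningful only if some \<open>(k, l)\<close>-dominating set exists; this is the case whenever
  \<open>l \<le> min_degree G + 1\<close>, since then the whole vertex set is one.
\<close>

definition kl_domination_number :: "('a, 'b) pre_digraph \<Rightarrow> nat \<Rightarrow> nat \<Rightarrow> nat" where
  "kl_domination_number G k l = Min (card ` {D. kl_dominating_set G k l D})"

end

theory Submission
  imports Defs
begin

text \<open>
  The proof is probabilistic. Write \<open>d = \<delta> + 1\<close> and put every vertex independently into a random
  set \<open>A\<close> with probability \<open>p = c\<mu>/d \<le> 1\<close>. Every vertex \<open>v\<close> whose closed neighbourhood meets \<open>A\<close> in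
  fewer than \<open>\<mu>\<close> elements is repaired by adding \<open>\<mu>\<close> elements of \<open>N[v]\<close> to \<open>A\<close>. The result meets every
  closed neighbourhood in at least \<open>\<mu>\<close> elements, hence is \<open>(k, l)\<close>-dominating, and its expected size
  is at most \<open>pn + \<mu> \<Sum>\<^sub>v P(|A \<inter> N[v]| < \<mu>)\<close>.

  The probabilities are bounded by Chernoff's method. For \<open>0 < z \<le> 1\<close>, Markov's inequality for the
  random variable \<open>z\<close> to the power \<open>|A \<inter> N[v]|\<close> gives
  \<open>P(|A \<inter> N[v]| < \<mu>) \<le> z\<^sup>-\<^sup>\<mu> (1 - p(1 - z))\<^sup>d\<close>, and \<open>z = 1/c\<close> is the choice that
  minimises \<open>z\<^sup>-\<^sup>\<mu> exp (- pd(1 - z))\<close>. With \<open>ln c \<le> (c - 1/c)/2\<close> the bound becomes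
  \<open>exp (- \<mu>(c + 1/c - 2)/2)\<close>; it is strict because \<open>1 - x < exp (- x)\<close> for \<open>x \<noteq> 0\<close>
  (\<open>chernoff_bound_strict\<close>).

  The graph enters only through the sizes of its closed neighbourhoods, so the random choice and the
  repair are carried out for arbitrary finite families of sets (\<open>small_multiple_hitting_set\<close>).

  As the vertex set is finite, expectations are written as weighted sums over its subsets; the
  whole analysis rests on the generating function of \<open>|A \<inter> N|\<close> (\<open>binomial_weight_generating_function\<close>).
\<close>

section \<open>Random subsets of a finite set\<close>

text \<open>The probability that a random subset of \<open>V\<close>, each element of which is selected independently
  with probability \<open>p\<close>, equals \<open>A\<close>.\<close>

definition binomial_weight :: "'a set \<Rightarrow> real \<Rightarrow> 'a set \<Rightarrow> real" where
  "binomial_weight V p A = p ^ card A * (1 - p) ^ card (V - A)"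

lemma binomial_weight_nonneg:
  "0 \<le> p \<Longrightarrow> p \<le> 1 \<Longrightarrow> 0 \<le> binomial_weight V p A"
  by (simp add: binomial_weight_def)

text \<open>Multiply out the product of the sums \<open>f v + (1 - p)\<close> over \<open>v \<in> V\<close>, where \<open>f v\<close> is \<open>pz\<close> for
  \<open>v \<in> N\<close> and \<open>p\<close> otherwise: choosing the first summand exactly for \<open>v \<in> A\<close> yields the
  term of \<open>A\<close>. The instances needed below are \<open>N = {}\<close> (total weight), \<open>z = 0\<close> with a singleton
  \<open>N\<close> (expected size), and \<open>0 < z < 1\<close> (the Chernoff bound).\<close>

lemma binomial_weight_generating_function:
  assumes "finite V" "N \<subseteq> V"
  shows "(\<Sum>A\<in>Pow V. binomial_weight V p A * z ^ card (A \<inter> N)) = (1 - p * (1 - z)) ^ card N"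
proof -
  define f where "f v = p * (if v \<in> N then z else 1)" for v
  have expand: "prod f A * (\<Prod>v\<in>V - A. 1 - p) = binomial_weight V p A * z ^ card (A \<inter> N)"
    if "A \<in> Pow V" for A
  proof -
    have "finite A" using that assms(1) finite_subset by auto
    then have "prod f A = p ^ card A * z ^ card (A \<inter> N)"
      by (simp add: f_def prod.distrib prod.If_cases Collect_mem_eq)
    then show ?thesis by (simp add: binomial_weight_def)
  qed
  have "(\<Sum>A\<in>Pow V. binomial_weight V p A * z ^ card (A \<inter> N))
      = (\<Sum>A\<in>Pow V. prod f A * (\<Prod>v\<in>V - A. 1 - p))"
    by (intro sum.cong refl expand[symmetric])
  also have "\<dots> = (\<Prod>v\<in>V. f v + (1 - p))"
    by (rule prod_add[OF assms(1), symmetric])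
  also have "\<dots> = (\<Prod>v\<in>V. if v \<in> N then 1 - p * (1 - z) else 1)"
    by (rule prod.cong) (auto simp: f_def algebra_simps)
  also have "\<dots> = (1 - p * (1 - z)) ^ card N"
    using assms by (simp add: prod.If_cases Int_absorb1)
  finally show ?thesis .
qed

lemma sum_binomial_weight:
  "finite V \<Longrightarrow> (\<Sum>A\<in>Pow V. binomial_weight V p A) = 1"
  using binomial_weight_generating_function[of V "{}" p 1] by simp

text \<open>By linearity of expectation, with \<open>1 - 0 ^ card (A \<inter> {v})\<close> as the indicator of \<open>v \<in> A\<close>.\<close>

lemma binomial_weight_expected_card:
  assumes "finite V"
  shows "(\<Sum>A\<in>Pow V. binomial_weight V p A * real (card A)) = p * real (card V)"
proof -
  have card: "real (card A) = (\<Sum>v\<in>V. 1 - 0 ^ card (A \<inter> {v}))" if "A \<in> Pow V" for A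
  proof -
    have "(\<Sum>v\<in>V. 1 - 0 ^ card (A \<inter> {v})) = (\<Sum>v\<in>V. if v \<in> A then 1 else (0::real))"
      by (rule sum.cong) auto
    also have "\<dots> = real (card (V \<inter> A))"
      using assms by (simp add: sum.If_cases)
    finally show ?thesis using that by (simp add: Int_absorb1)
  qed
  have "(\<Sum>A\<in>Pow V. binomial_weight V p A * real (card A))
      = (\<Sum>A\<in>Pow V. \<Sum>v\<in>V. binomial_weight V p A * (1 - 0 ^ card (A \<inter> {v})))"
    by (intro sum.cong refl) (simp only: card sum_distrib_left)
  also have "\<dots> = (\<Sum>v\<in>V. (\<Sum>A\<in>Pow V. binomial_weight V p A)
                    - (\<Sum>A\<in>Pow V. binomial_weight V p A * 0 ^ card (A \<inter> {v})))"
    by (subst sum.swap) (simp add: right_diff_distrib sum_subtractf)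
  also have "\<dots> = (\<Sum>v\<in>V. p)"
    using assms
    by (intro sum.cong refl) (simp add: sum_binomial_weight binomial_weight_generating_function)
  finally show ?thesis by (simp add: mult.commute)
qed

lemma ex_subset_le_expectation:
  assumes "finite V" "0 \<le> p" "p \<le> 1"
    and expectation: "(\<Sum>A\<in>Pow V. binomial_weight V p A * F A) \<le> b"
  shows "\<exists>A \<subseteq> V. F A \<le> b"
proof (rule ccontr)
  assume "\<not> ?thesis"
  then have above: "b < F A" if "A \<in> Pow V" for A
    using that by (auto simp: not_le)
  let ?w = "binomial_weight V p"
  have nonneg: "0 \<le> ?w A" for A
    using assms by (intro binomial_weight_nonneg)
  have "\<exists>A\<in>Pow V. ?w A \<noteq> 0"
    using sum_binomial_weight[OF assms(1), of p] by (metis sum.neutral zero_neq_one)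
  then obtain A where A: "A \<in> Pow V" "?w A \<noteq> 0" ..
  then have pos: "0 < ?w A" using nonneg[of A] by simp
  have "(\<Sum>A\<in>Pow V. ?w A * b) < (\<Sum>A\<in>Pow V. ?w A * F A)"
  proof (rule sum_strict_mono_ex1)
    show "finite (Pow V)" using assms(1) by simp
    show "\<forall>A\<in>Pow V. ?w A * b \<le> ?w A * F A"
      using above nonneg by (blast intro: mult_left_mono less_imp_le)
    show "\<exists>A\<in>Pow V. ?w A * b < ?w A * F A"
      using A(1) above[OF A(1)] pos mult_strict_left_mono by blast
  qed
  then show False
    using expectation assms(1) by (simp add: sum_distrib_right[symmetric] sum_binomial_weight)
qed

section \<open>Multiple hitting sets\<close>

text \<open>Each set \<open>N i\<close> that \<open>A\<close> meets in fewer than \<open>m\<close> elements is charged \<open>m\<close> new elements, taken from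
  \<open>N i\<close>. Charging \<open>m\<close> rather than the deficit \<open>m - |A \<inter> N i|\<close> leaves only the number of deficient
  sets to be estimated; this is the source of the factor \<open>\<mu>\<close> in front of the exponential term.\<close>

lemma repair_to_multiple_hitting_set:
  fixes N :: "'i \<Rightarrow> 'a set"
  assumes "finite V" "finite I" "A \<subseteq> V"
    and sub: "\<And>i. i \<in> I \<Longrightarrow> N i \<subseteq> V" and large: "\<And>i. i \<in> I \<Longrightarrow> m \<le> card (N i)"
  shows "\<exists>D \<subseteq> V. (\<forall>i\<in>I. m \<le> card (N i \<inter> D)) \<and>
           card D \<le> card A + m * card {i \<in> I. card (A \<inter> N i) < m}"
proof -
  define B where "B = {i \<in> I. card (A \<inter> N i) < m}"
  have "\<exists>S. S \<subseteq> N i \<and> card S = m" if "i \<in> I" for i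
    using large[OF that] by (metis obtain_subset_with_card_n)
  then obtain S where S: "\<And>i. i \<in> I \<Longrightarrow> S i \<subseteq> N i \<and> card (S i) = m"
    by metis
  define D where "D = A \<union> (\<Union>i\<in>B. S i)"
  have "D \<subseteq> V"
    using assms(3) S sub unfolding D_def B_def by fastforce
  have "finite B" using assms(2) by (simp add: B_def)
  have "m \<le> card (N i \<inter> D)" if "i \<in> I" for i
  proof -
    have fin: "finite (N i \<inter> D)"
      using \<open>D \<subseteq> V\<close> assms(1) by (meson finite_Int finite_subset)
    show ?thesis
    proof (cases "i \<in> B")
      case True
      then have "S i \<subseteq> N i \<inter> D" using S[OF that] by (auto simp: D_def)
      then show ?thesis using S[OF that] card_mono[OF fin] by force
    next
      case False
      then have "m \<le> card (A \<inter> N i)" using that by (simp add: B_def)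
      also have "\<dots> \<le> card (N i \<inter> D)" by (rule card_mono[OF fin]) (auto simp: D_def)
      finally show ?thesis .
    qed
  qed
  moreover have "card D \<le> card A + m * card B"
  proof -
    have "card D \<le> card A + card (\<Union>i\<in>B. S i)"
      unfolding D_def by (rule card_Un_le)
    also have "card (\<Union>i\<in>B. S i) \<le> (\<Sum>i\<in>B. card (S i))"
      by (rule card_UN_le[OF \<open>finite B\<close>])
    also have "(\<Sum>i\<in>B. card (S i)) = m * card B"
      using S by (simp add: B_def)
    finally show ?thesis by simp
  qed
  ultimately show ?thesis
    using \<open>D \<subseteq> V\<close> unfolding B_def by blast
qed

text \<open>The set function \<open>F\<close> of the proof bounds the size of the repaired set: if \<open>A\<close> meets \<open>N i\<close> in
  fewer than \<open>m\<close> elements, then the summand of \<open>i\<close> is at least \<open>1\<close>. Its expectation, unlike the tail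
  probability itself, is given exactly by the generating function.\<close>

lemma small_multiple_hitting_set:
  fixes N :: "'i \<Rightarrow> 'a set" and p z :: real
  assumes "finite V" "finite I"
    and sub: "\<And>i. i \<in> I \<Longrightarrow> N i \<subseteq> V" and large: "\<And>i. i \<in> I \<Longrightarrow> d \<le> card (N i)"
    and "m \<le> d" and p: "0 \<le> p" "p \<le> 1" and z: "0 < z" "z \<le> 1"
  shows "\<exists>D \<subseteq> V. (\<forall>i\<in>I. m \<le> card (N i \<inter> D)) \<and>
           real (card D) \<le> p * card V + m * (card I * ((1 - p * (1 - z)) ^ d / z ^ m))"
proof -
  define F where "F A = card A + real m * (\<Sum>i\<in>I. z ^ card (A \<inter> N i) / z ^ m)" for A
  let ?w = "binomial_weight V p"
  let ?q = "1 - p * (1 - z)"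
  have q: "0 \<le> ?q" "?q \<le> 1"
    using p z mult_le_one[of p "1 - z"] by auto
  have "(\<Sum>A\<in>Pow V. ?w A * F A)
      = (\<Sum>A\<in>Pow V. ?w A * card A)
        + (\<Sum>A\<in>Pow V. \<Sum>i\<in>I. m / z ^ m * (?w A * z ^ card (A \<inter> N i)))"
    by (simp add: F_def distrib_left sum.distrib sum_distrib_left mult_ac)
  also have "\<dots> = p * card V + (\<Sum>i\<in>I. m / z ^ m * (\<Sum>A\<in>Pow V. ?w A * z ^ card (A \<inter> N i)))"
    using assms(1) by (subst sum.swap) (simp add: binomial_weight_expected_card sum_distrib_left)
  also have "\<dots> = p * card V + (\<Sum>i\<in>I. m / z ^ m * ?q ^ card (N i))"
    using assms(1) sub by (simp add: binomial_weight_generating_function)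
  also have "\<dots> \<le> p * card V + (\<Sum>i\<in>I. m / z ^ m * ?q ^ d)"
    using z q large by (intro add_left_mono sum_mono mult_left_mono power_decreasing) auto
  also have "\<dots> = p * card V + m * (card I * (?q ^ d / z ^ m))"
    by simp
  finally obtain A where A: "A \<subseteq> V" "F A \<le> p * card V + m * (card I * (?q ^ d / z ^ m))"
    using ex_subset_le_expectation[OF assms(1) p, of F] by blast
  let ?B = "{i \<in> I. card (A \<inter> N i) < m}"
  have "m \<le> card (N i)" if "i \<in> I" for i
    using \<open>m \<le> d\<close> large[OF that] by simp
  from repair_to_multiple_hitting_set[where N = N and m = m, OF assms(1,2) A(1) sub this]
  obtain D where D: "D \<subseteq> V" "\<forall>i\<in>I. m \<le> card (N i \<inter> D)" "card D \<le> card A + m * card ?B"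
    by auto
  have "real (card ?B) = (\<Sum>i\<in>?B. 1)" by simp
  also have "\<dots> \<le> (\<Sum>i\<in>?B. z ^ card (A \<inter> N i) / z ^ m)"
    using z by (intro sum_mono) (auto simp: power_decreasing)
  also have "\<dots> \<le> (\<Sum>i\<in>I. z ^ card (A \<inter> N i) / z ^ m)"
    using z assms(2) by (intro sum_mono2) auto
  finally have "card A + real m * card ?B \<le> F A"
    by (simp add: F_def mult_left_mono)
  moreover have "real (card D) \<le> card A + real m * card ?B"
    using of_nat_mono[OF D(3), where 'a = real] by simp
  ultimately have "real (card D) \<le> p * card V + m * (card I * (?q ^ d / z ^ m))"
    using A(2) by linarith
  with D(1,2) show ?thesis by (intro exI[of _ D] conjI)
qed

text \<open>The factor \<open>c ^ m\<close> is at most \<open>exp (m(c - 1/c)/2)\<close> because \<open>t \<le> sinh t\<close> for \<open>t = ln c\<close>, the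
  other factor is below \<open>exp (- m(c - 1))\<close>, and \<open>(c - 1/c)/2 - (c - 1) = - (c + 1/c - 2)/2\<close>.\<close>

lemma chernoff_bound_strict:
  fixes c :: real
  assumes "c > 1" "m > 0" "c * real m \<le> real d"
  shows "(1 - c * real m / real d * (1 - 1 / c)) ^ d / (1 / c) ^ m
       < 1 / exp (0.5 * real m * (c + 1 / c - 2))"
proof -
  let ?x = "c * real m / real d * (1 - 1 / c)"
  have "0 < c * real m" using assms by simp
  then have d: "0 < d" using assms(3) by (cases d) auto
  have x0: "0 < ?x" using assms d by simp
  have "?x \<le> 1"
    using assms d by (intro mult_le_one) auto
  have "(1 - ?x) ^ d < exp (- ?x) ^ d"
    using x0 \<open>?x \<le> 1\<close> d exp_minus_greater[of ?x] by (intro power_strict_mono) auto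
  also have "exp (- ?x) ^ d = exp (- (real m * (c - 1)))"
    using d assms(1) by (simp add: exp_of_nat_mult[symmetric] field_simps)
  finally have below: "(1 - ?x) ^ d < exp (- (real m * (c - 1)))" .
  have "ln c \<le> (c - 1 / c) / 2"
    using real_le_x_sinh[of "ln c"] assms(1) by (simp add: inverse_eq_divide)
  then have "real m * ln c \<le> real m * ((c - 1 / c) / 2)"
    by (intro mult_left_mono) auto
  moreover have "c ^ m = exp (real m * ln c)"
    using assms(1) by (simp add: exp_of_nat_mult)
  ultimately have power: "c ^ m \<le> exp (real m * ((c - 1 / c) / 2))"
    by simp
  have "(1 - ?x) ^ d / (1 / c) ^ m = (1 - ?x) ^ d * c ^ m"
    by (simp add: power_one_over)
  also have "\<dots> < exp (- (real m * (c - 1))) * c ^ m"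
    using below assms(1) by (intro mult_strict_right_mono) auto
  also have "\<dots> \<le> exp (- (real m * (c - 1))) * exp (real m * ((c - 1 / c) / 2))"
    using power by (intro mult_left_mono) auto
  also have "\<dots> = exp (- (0.5 * real m * (c + 1 / c - 2)))"
    unfolding exp_add[symmetric] by (rule arg_cong[where f = exp]) (simp add: field_simps)
  also have "\<dots> = 1 / exp (0.5 * real m * (c + 1 / c - 2))"
    by (simp add: exp_minus inverse_eq_divide)
  finally show ?thesis .
qed

section \<open>Closed neighbourhoods and domination\<close>

lemma (in digraph) card_closed_nbhd:
  "card (closed_nbhd G v) = out_degree G v + 1"
proof -
  have "{u \<in> verts G. v \<rightarrow>\<^bsub>G\<^esub> u} = head G ` out_arcs G v"
    by (auto simp: arcs_ends_conv image_iff)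
  moreover have "inj_on (head G) (out_arcs G v)"
    by (rule inj_onI) (auto intro: no_multi_arcs simp: arc_to_ends_def)
  ultimately have "card {u \<in> verts G. v \<rightarrow>\<^bsub>G\<^esub> u} = out_degree G v"
    by (simp add: card_image out_degree_def)
  moreover have "v \<notin> {u \<in> verts G. v \<rightarrow>\<^bsub>G\<^esub> u}"
    using no_loops by (fastforce simp: arcs_ends_conv)
  ultimately show ?thesis
    by (simp add: closed_nbhd_def)
qed

lemma (in fin_digraph) kl_domination_number_le:
  assumes "kl_dominating_set G k l D"
  shows "kl_domination_number G k l \<le> card D"
proof -
  have "{D. kl_dominating_set G k l D} \<subseteq> Pow (verts G)"
    by (auto simp: kl_dominating_set_def)
  then have "finite {D. kl_dominating_set G k l D}"
    using finite_verts by (meson finite_Pow_iff finite_subset)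
  then show ?thesis
    unfolding kl_domination_number_def using assms by (intro Min_le) auto
qed

theorem theorem9:
  fixes G :: "('a, 'b) pre_digraph" and k l \<mu> :: nat and c :: real
  assumes "Digraph.graph G" and "verts G \<noteq> {}"
    and "k \<ge> 1" and "l \<ge> 1" and "\<mu> = max k l" and "c > 1"
    and "real (min_degree G) \<ge> c * real \<mu> - 1"
  shows "real (kl_domination_number G k l)
    < (c / (real (min_degree G) + 1) + 1 / exp (0.5 * real \<mu> * (c + 1 / c - 2)))
      * real \<mu> * real (card (verts G))"
proof -
  interpret Digraph.graph G by fact
  define d where "d = min_degree G + 1"
  define p where "p = c * real \<mu> / real d"
  let ?n = "card (verts G)"
  let ?e = "1 / exp (0.5 * real \<mu> * (c + 1 / c - 2))"
  let ?t = "(1 - p * (1 - 1 / c)) ^ d / (1 / c) ^ \<mu>"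
  have d: "c * real \<mu> \<le> real d" "0 < d"
    using assms(7) by (auto simp: d_def)
  have \<mu>: "0 < \<mu>" using assms(3,5) by auto
  have "real \<mu> \<le> c * real \<mu>" using assms(6) mult_right_mono[of 1 c "real \<mu>"] by simp
  then have "\<mu> \<le> d" using d(1) by linarith
  have p: "0 \<le> p" "p \<le> 1" using d assms(6) by (auto simp: p_def)
  have n: "0 < ?n" using assms(2) by (simp add: card_gt_0_iff)
  have "d \<le> card (closed_nbhd G v)" if "v \<in> verts G" for v
    using that by (simp add: d_def card_closed_nbhd min_degree_def)
  moreover have "closed_nbhd G v \<subseteq> verts G" if "v \<in> verts G" for v
    using that by (auto simp: closed_nbhd_def)
  ultimately obtain D where D: "D \<subseteq> verts G" "\<forall>v\<in>verts G. \<mu> \<le> card (closed_nbhd G v \<inter> D)"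
    and card_D: "real (card D) \<le> p * ?n + \<mu> * (?n * ?t)"
    using small_multiple_hitting_set[of "verts G" "verts G" "closed_nbhd G" d \<mu> p "1 / c"]
      \<open>\<mu> \<le> d\<close> p assms(6) by auto
  have "kl_dominating_set G k l D"
    using D assms(5) by (auto simp: kl_dominating_set_def)
  then have "real (kl_domination_number G k l) \<le> real (card D)"
    by (simp add: kl_domination_number_le)
  also note card_D
  also have "p * ?n + \<mu> * (?n * ?t) < p * ?n + \<mu> * (?n * ?e)"
    using chernoff_bound_strict[OF assms(6) \<mu> d(1), folded p_def] n \<mu>
    by (intro add_strict_left_mono mult_strict_left_mono) auto
  also have "\<dots> = (c / (real (min_degree G) + 1) + ?e) * real \<mu> * real ?n"
    by (simp add: p_def d_def algebra_simps)
  finally show ?thesis .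
qed

end
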